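(* Let $n,m\in\mathbb{R}$ and let $p\in H^1(\mathbb{R})$. Then $$\mathcal{E}[1+p]=\frac12\|p\|_{H^1}^2+O(\|p\|_{H^1}^3)\qquad\text{as }\|p\|_{H^1}\to0 .$$
   Context: $\|p\|_{H^1}^2=\int_{\mathbb{R}}(p^2+p_z^2)\,dz$. The functional $\mathcal{E}$ (depending on $n,m$) is $$\mathcal{E}[\phi]=\int_{\mathbb{R}}\Big(\tfrac12\phi^{-2m}\phi_z^2+V_{n,m}(\phi)\Big)dz,$$ where $$V_{n,m}(x)=\begin{cases}x\log x-x+1,& n+m=1,\\ -\log x+x-1,& n+m=2,\\ \dfrac{x^{2-n-m}-1+(n+m-2)(x-1)}{(n+m-1)(n+m-2)},& n+m\ne1,2.\end{cases}$$ *)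

theory Defs
  imports "HOL-Analysis.Analysis" "HOL-Library.Landau_Symbols"
begin

text \<open>Elements of \<open>H\<^sup>1(\<real>)\<close> are represented by Borel functions; nothing below depends on the choice of
  representative modulo Lebesgue-null sets.\<close>

definition test_functions :: "(real \<Rightarrow> real) set" where
  "test_functions =
     {\<eta>. (\<forall>k x. (deriv ^^ k) \<eta> differentiable at x) \<and> compact (closure {x. \<eta> x \<noteq> 0})}"

definition locally_integrable :: "(real \<Rightarrow> real) \<Rightarrow> bool" where
  "locally_integrable f \<longleftrightarrow>
     f \<in> borel_measurable lborel \<and> (\<forall>K. compact K \<longrightarrow> set_integrable lborel K f)"

definition has_weak_derivative :: "(real \<Rightarrow> real) \<Rightarrow> (real \<Rightarrow> real) \<Rightarrow> bool" where
  "has_weak_derivative f g \<longleftrightarrow>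
     locally_integrable f \<and> locally_integrable g \<and>
     (\<forall>\<eta>\<in>test_functions. (LBINT z. f z * deriv \<eta> z) = - (LBINT z. g z * \<eta> z))"

text \<open>A weak derivative is unique up to null sets, so the choice made here is immaterial under
  integrals. If \<open>f\<close> has no weak derivative, the value is unspecified.\<close>

definition weak_deriv :: "(real \<Rightarrow> real) \<Rightarrow> real \<Rightarrow> real" where
  "weak_deriv f = (SOME g. has_weak_derivative f g)"

definition H1 :: "(real \<Rightarrow> real) set" where
  "H1 = {p. p \<in> borel_measurable lborel \<and> integrable lborel (\<lambda>z. (p z)\<^sup>2) \<and>
            (\<exists>g. has_weak_derivative p g \<and> integrable lborel (\<lambda>z. (g z)\<^sup>2))}"

definition H1_norm :: "(real \<Rightarrow> real) \<Rightarrow> real" where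
  "H1_norm p = sqrt (LBINT z. (p z)\<^sup>2 + (weak_deriv p z)\<^sup>2)"

text \<open>The filter ``\<open>p \<in> H\<^sup>1(\<real>)\<close>, \<open>\<parallel>p\<parallel> \<rightarrow> 0\<close>'': a property holds eventually iff it holds for all
  \<open>p \<in> H\<^sup>1(\<real>)\<close> of sufficiently small norm.\<close>

definition H1_to_zero :: "(real \<Rightarrow> real) filter" where
  "H1_to_zero = inf (filtercomap H1_norm (nhds 0)) (principal H1)"

definition V :: "real \<Rightarrow> real \<Rightarrow> real \<Rightarrow> real" where
  "V n m x =
     (if n + m = 1 then x * ln x - x + 1
      else if n + m = 2 then - ln x + x - 1
      else (x powr (2 - n - m) - 1 + (n + m - 2) * (x - 1)) / ((n + m - 1) * (n + m - 2)))"

text \<open>The real power and logarithm carry their usual meaning only where \<open>\<phi>\<close> is positive.\<close>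

definition energy_density :: "real \<Rightarrow> real \<Rightarrow> (real \<Rightarrow> real) \<Rightarrow> real \<Rightarrow> real" where
  "energy_density n m \<phi> z =
     1 / 2 * \<phi> z powr (- 2 * m) * (weak_deriv \<phi> z)\<^sup>2 + V n m (\<phi> z)"

text \<open>By the convention for the Bochner integral this is \<open>0\<close> if the density is not integrable.\<close>

definition energy :: "real \<Rightarrow> real \<Rightarrow> (real \<Rightarrow> real) \<Rightarrow> real" where
  "energy n m \<phi> = (LBINT z. energy_density n m \<phi> z)"

end

theory Submission
  imports Defs
begin

text \<open>The embedding of \<open>H\<^sup>1(\<real>)\<close> into \<open>L\<^sup>\<infinity>(\<real>)\<close> gives \<open>\<bar>p\<bar> \<le> C \<parallel>p\<parallel>\<close> almost everywhere, so for small norms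
  \<open>1 + p\<close> stays in \<open>[1/2, 3/2]\<close>. There \<open>x powr (-2m) = 1 + O(\<bar>x - 1\<bar>)\<close> and
  \<open>V x = (x - 1)\<^sup>2/2 + O(\<bar>x - 1\<bar>\<^sup>3)\<close>, so the energy density differs from \<open>(p\<^sup>2 + p\<^sub>z\<^sup>2)/2\<close> by at most a
  multiple of \<open>\<parallel>p\<parallel> (p\<^sup>2 + p\<^sub>z\<^sup>2)\<close>.

  The embedding is obtained by duality, without a continuous representative of \<open>p\<close>: it suffices to
  bound \<open>\<bar>\<integral> p \<phi>\<bar>\<close> by \<open>C \<parallel>p\<parallel> \<integral> \<phi>\<close> for nonnegative test functions \<open>\<phi>\<close> supported in an interval of
  length \<open>2\<close>.\<close>

subsection \<open>Smooth functions built from \<open>exp (-1/t)\<close>\<close>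

text \<open>With \<open>u = 1 / t\<close> these are the functions P(u) exp(-u), extended by 0 to
  \<open>t \<le> 0\<close>. The polynomial factor is carried along because differentiation
  reproduces this form; \<open>P = 1\<close> gives the classical flat function exp(-1/t).\<close>

definition flat_fun :: "real poly \<Rightarrow> real \<Rightarrow> real" where
  "flat_fun P t = (if 0 < t then poly P (inverse t) * exp (- inverse t) else 0)"

lemma poly_times_exp_minus_tendsto_0:
  "((\<lambda>u::real. poly P u * exp (- u)) \<longlongrightarrow> 0) at_top"
proof -
  have "((\<lambda>u::real. \<Sum>i\<le>degree P. coeff P i * (u ^ i / exp u)) \<longlongrightarrow> (\<Sum>i\<le>degree P. coeff P i * 0)) at_top"
    by (intro tendsto_intros tendsto_power_div_exp_0)
  then show ?thesis
    by (simp add: poly_altdef exp_minus sum_distrib_right sum_divide_distrib field_simps)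
qed

lemma flat_fun_tendsto_0: "(flat_fun P \<longlongrightarrow> 0) (at 0)"
proof -
  have "((\<lambda>t. poly P (inverse t) * exp (- inverse t)) \<longlongrightarrow> 0) (at_right (0::real))"
    using filterlim_compose[OF poly_times_exp_minus_tendsto_0 filterlim_inverse_at_top_right] .
  then have r: "(flat_fun P \<longlongrightarrow> 0) (at_right 0)"
    by (rule Lim_transform_eventually)
       (auto simp: flat_fun_def eventually_at_filter)
  have l: "(flat_fun P \<longlongrightarrow> 0) (at_left 0)"
    by (rule tendsto_eventually) (auto simp: flat_fun_def eventually_at_filter)
  show ?thesis using filterlim_split_at[OF l r] .
qed

text \<open>For \<open>u = 1 / t\<close> one has d/dt = -u^2 d/du, so P(u) exp(-u) has derivative
  u^2 (P - P')(u) exp(-u), and \<open>[:0, 0, 1:]\<close> is the polynomial u^2. Only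
  \<open>t = 0\<close> needs a limit argument.\<close>

lemma DERIV_flat_fun:
  "(flat_fun P has_real_derivative flat_fun ([:0, 0, 1:] * (P - pderiv P)) t) (at t)"
proof -
  consider "t < 0" | "t = 0" | "t > 0" by linarith
  then show ?thesis
  proof cases
    case 1
    have "((\<lambda>_. 0) has_real_derivative 0) (at t)" by simp
    then have "(flat_fun P has_real_derivative 0) (at t)"
      by (rule has_field_derivative_transform_within_open[where S="{..<0}"])
         (use 1 in \<open>auto simp: flat_fun_def\<close>)
    with 1 show ?thesis by (simp add: flat_fun_def)
  next
    case 2
    have "((\<lambda>h. flat_fun (pCons 0 P) h) \<longlongrightarrow> 0) (at 0)"
      by (rule flat_fun_tendsto_0)
    \<comment> \<open>Division by \<open>h\<close> multiplies the polynomial in 1/h by its variable,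
      so the difference quotient at 0 is again a flat function and tends to 0.\<close>
    moreover have "flat_fun (pCons 0 P) = (\<lambda>h. (flat_fun P (0 + h) - flat_fun P 0) / h)"
      by (auto simp: flat_fun_def fun_eq_iff field_simps)
    ultimately have "(flat_fun P has_real_derivative 0) (at 0)"
      unfolding DERIV_def by simp
    with 2 show ?thesis by (simp add: flat_fun_def)
  next
    case 3
    have "((\<lambda>t. poly P (inverse t) * exp (- inverse t)) has_real_derivative
           poly ([:0, 0, 1:] * (P - pderiv P)) (inverse t) * exp (- inverse t)) (at t)"
      using 3
      by (auto intro!: derivative_eq_intros DERIV_chain2[OF poly_DERIV] simp: power2_eq_square algebra_simps)
    then have "(flat_fun P has_real_derivative
           poly ([:0, 0, 1:] * (P - pderiv P)) (inverse t) * exp (- inverse t)) (at t)"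
      by (rule has_field_derivative_transform_within_open[where S="{0<..}"])
         (use 3 in \<open>auto simp: flat_fun_def\<close>)
    with 3 show ?thesis by (simp add: flat_fun_def)
  qed
qed

text \<open>An inductively generated class closed under \<open>deriv\<close>. Membership gives
  differentiability of every order at once, so no formula for higher derivatives of products is ever
  required.\<close>

inductive_set smooth_alg :: "(real \<Rightarrow> real) set" where
  const: "(\<lambda>_. c) \<in> smooth_alg"
| flat: "(\<lambda>x. flat_fun P (\<alpha> * x + \<beta>)) \<in> smooth_alg"
| add: "f \<in> smooth_alg \<Longrightarrow> g \<in> smooth_alg \<Longrightarrow> (\<lambda>x. f x + g x) \<in> smooth_alg"
| mult: "f \<in> smooth_alg \<Longrightarrow> g \<in> smooth_alg \<Longrightarrow> (\<lambda>x. f x * g x) \<in> smooth_alg"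

lemma smooth_alg_diff: 
  assumes "f \<in> smooth_alg" "g \<in> smooth_alg"
  shows "(\<lambda>x. f x - g x) \<in> smooth_alg"
  using smooth_alg.add[OF assms(1) smooth_alg.mult[OF smooth_alg.const[of "-1"] assms(2)]] by simp

lemma smooth_alg_prod:
  assumes "\<And>i. i \<in> I \<Longrightarrow> f i \<in> smooth_alg"
  shows "(\<lambda>x. \<Prod>i\<in>I. f i x) \<in> smooth_alg"
  using assms by (induction I rule: infinite_finite_induct) (auto intro: smooth_alg.intros)

lemma smooth_alg_has_derivative:
  assumes "f \<in> smooth_alg"
  shows "\<exists>f'\<in>smooth_alg. \<forall>x. (f has_real_derivative f' x) (at x)"
  using assms
proof induction
  case (const c)
  show ?case by (rule bexI[OF _ smooth_alg.const[of 0]]) auto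
next
  case (flat P \<alpha> \<beta>)
  let ?Q = "[:0, 0, 1:] * (P - pderiv P)"
  have "((\<lambda>x. flat_fun P (\<alpha> * x + \<beta>)) has_real_derivative \<alpha> * flat_fun ?Q (\<alpha> * x + \<beta>)) (at x)" for x
    by (rule DERIV_cong, rule DERIV_chain2[OF DERIV_flat_fun]) (auto intro!: derivative_eq_intros)
  then show ?case
    by (intro bexI[OF _ smooth_alg.mult[OF smooth_alg.const[of \<alpha>] smooth_alg.flat[of ?Q \<alpha> \<beta>]]]) auto
next
  case (add f g)
  then obtain f' g' where "f' \<in> smooth_alg" "g' \<in> smooth_alg"
    "\<And>x. (f has_real_derivative f' x) (at x)" "\<And>x. (g has_real_derivative g' x) (at x)" by blast
  then show ?case
    by (intro bexI[of _ "\<lambda>x. f' x + g' x"]) (auto intro: smooth_alg.intros derivative_intros)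
next
  case (mult f g)
  then obtain f' g' where "f' \<in> smooth_alg" "g' \<in> smooth_alg"
    "\<And>x. (f has_real_derivative f' x) (at x)" "\<And>x. (g has_real_derivative g' x) (at x)" by blast
  with mult.hyps show ?case
    by (intro bexI[of _ "\<lambda>x. f' x * g x + g' x * f x"])
       (auto intro: smooth_alg.intros DERIV_mult)
qed

lemma smooth_alg_deriv:
  assumes "f \<in> smooth_alg" shows "deriv f \<in> smooth_alg"
proof -
  obtain f' where "f' \<in> smooth_alg" "\<And>x. (f has_real_derivative f' x) (at x)"
    using smooth_alg_has_derivative[OF assms] by blast
  then have "deriv f = f'" by (auto simp: fun_eq_iff intro: DERIV_imp_deriv)
  with \<open>f' \<in> smooth_alg\<close> show ?thesis by simp
qed

lemma smooth_alg_differentiable: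
  "f \<in> smooth_alg \<Longrightarrow> f differentiable at x"
  using smooth_alg_has_derivative by (meson real_differentiable_def)

lemma smooth_alg_continuous_on: "f \<in> smooth_alg \<Longrightarrow> continuous_on S f"
  by (meson continuous_at_imp_continuous_on differentiable_imp_continuous_within smooth_alg_differentiable)

lemma smooth_alg_higher_deriv: "f \<in> smooth_alg \<Longrightarrow> (deriv ^^ k) f \<in> smooth_alg"
  by (induction k) (auto intro: smooth_alg_deriv)

text \<open>\<open>smooth_alg\<close> is not known to contain antiderivatives, so
  \<open>\<eta>\<close> enters only through its derivative: order 0 comes from the assumed
  derivative, and every higher order is a derivative of \<open>\<phi>\<close>.\<close>

lemma antiderivative_in_test_functions:
  assumes "\<phi> \<in> smooth_alg" and d: "\<And>x. (\<eta> has_real_derivative \<phi> x) (at x)"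
    and "\<And>x. x \<notin> {a..b} \<Longrightarrow> \<eta> x = 0"
  shows "\<eta> \<in> test_functions" "deriv \<eta> = \<phi>"
proof -
  show e: "deriv \<eta> = \<phi>" using d by (auto simp: fun_eq_iff intro: DERIV_imp_deriv)
  have "(deriv ^^ k) \<eta> differentiable at x" for k x
  proof (cases k)
    case 0
    with d show ?thesis by (auto simp: real_differentiable_def)
  next
    case (Suc j)
    then have "(deriv ^^ k) \<eta> = (deriv ^^ j) \<phi>" by (simp add: funpow_Suc_right e del: funpow.simps)
    then show ?thesis by (simp add: assms smooth_alg_differentiable smooth_alg_higher_deriv)
  qed
  moreover have "compact (closure {x. \<eta> x \<noteq> 0})"
    using assms(3) by (intro compact_closure[THEN iffD2] bounded_subset[OF bounded_closed_interval[of a b]]) blast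
  ultimately show "\<eta> \<in> test_functions" by (auto simp: test_functions_def)
qed

section \<open>Bump functions and antiderivatives\<close>

definition bump :: "real \<Rightarrow> real \<Rightarrow> real \<Rightarrow> real \<Rightarrow> real" where
  "bump k c d x = flat_fun 1 (k * (x - c)) * flat_fun 1 (k * (d - x))"

lemma flat_fun_1_bounds: "0 \<le> flat_fun 1 t" "flat_fun 1 t \<le> 1"
  by (auto simp: flat_fun_def)

lemma bump_bounds: "0 \<le> bump k c d x" "bump k c d x \<le> 1"
  by (auto simp: bump_def flat_fun_1_bounds mult_le_one)

lemma bump_eq_0: "0 \<le> k \<Longrightarrow> x \<notin> {c<..<d} \<Longrightarrow> bump k c d x = 0"
  by (auto simp: bump_def flat_fun_def zero_less_mult_iff)

lemma bump_pos: "0 < k \<Longrightarrow> x \<in> {c<..<d} \<Longrightarrow> 0 < bump k c d x"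
  by (auto simp: bump_def flat_fun_def)

lemma bump_smooth: "bump k c d \<in> smooth_alg"
proof -
  have "bump k c d = (\<lambda>x. flat_fun 1 (k * x + (- k * c)) * flat_fun 1 ((- k) * x + k * d))"
    by (auto simp: bump_def fun_eq_iff algebra_simps)
  then show ?thesis by (simp only:) (intro smooth_alg.intros)
qed

text \<open>The parameter \<open>k\<close> controls steepness: for fixed \<open>t > 0\<close> the
  value exp(-1/(k t)) tends to 1. As each bump vanishes off the interval, the bumps converge
  pointwise to its indicator.\<close>

lemma bump_tendsto_1:
  assumes "x \<in> {c<..<d}"
  shows "(\<lambda>k::nat. bump (real k) c d x) \<longlonglongrightarrow> 1"
proof -
  have *: "(\<lambda>k::nat. flat_fun 1 (real k * t)) \<longlonglongrightarrow> 1" if "t > 0" for t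
  proof (rule Lim_transform_eventually)
    have "(\<lambda>k. exp (- (inverse t * inverse (real k)))) \<longlonglongrightarrow> exp (- (inverse t * 0))"
      by (intro tendsto_intros lim_inverse_n)
    then show "(\<lambda>k. exp (- (inverse t * inverse (real k)))) \<longlonglongrightarrow> 1" by simp
    show "\<forall>\<^sub>F k in sequentially. exp (- (inverse t * inverse (real k))) = flat_fun 1 (real k * t)"
      using eventually_gt_at_top[of 0] by eventually_elim (use that in \<open>auto simp: flat_fun_def field_simps\<close>)
  qed
  have "(\<lambda>k::nat. bump (real k) c d x) \<longlonglongrightarrow> 1 * 1"
    unfolding bump_def by (intro tendsto_mult *) (use assms in auto)
  then show ?thesis by simp
qed

text \<open>Since \<open>\<phi>\<close> is nonnegative and vanishes off the interval, any
  antiderivative \<open>F\<close> is nondecreasing and constant on each side. Normalised by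
  \<open>F a = 0\<close>, it climbs from 0 to the total mass of \<open>\<phi>\<close>.\<close>

lemma antiderivative_bounds:
  assumes "\<phi> \<in> smooth_alg" "\<And>x. 0 \<le> \<phi> x" "\<And>x. x \<notin> {a<..<b} \<Longrightarrow> \<phi> x = 0" "a \<le> b"
  shows "\<exists>\<Phi>. \<forall>x. (\<Phi> has_real_derivative \<phi> x) (at x) \<and> (x \<le> a \<longrightarrow> \<Phi> x = 0) \<and>
    (b \<le> x \<longrightarrow> \<Phi> x = (LBINT x. \<phi> x)) \<and> 0 \<le> \<Phi> x \<and> \<Phi> x \<le> (LBINT x. \<phi> x)"
proof -
  have cont: "isCont \<phi> x" for x
    using smooth_alg_continuous_on[OF assms(1), of UNIV] by (simp add: continuous_on_eq_continuous_at)
  obtain F where F: "\<And>x. (F has_real_derivative \<phi> x) (at x)"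
    using einterval_antiderivative[of "-\<infinity>" "\<infinity>" \<phi>] cont
    by (auto simp: has_real_derivative_iff_has_vector_derivative)
  have mono: "F x \<le> F y" if "x \<le> y" for x y
    using DERIV_nonneg_imp_nondecreasing[OF that] F assms(2) by blast
  have l: "F x = F a" if "x \<le> a" for x
  proof (cases "x = a")
    case False
    with that have "x < a" by simp
    then obtain z where "x < z" "z < a" "F a - F x = (a - x) * \<phi> z" using MVT2 F by blast
    with assms(3) show ?thesis by simp
  qed simp
  have r: "F x = F b" if "b \<le> x" for x
  proof (cases "x = b")
    case False
    with that have "b < x" by simp
    then obtain z where "b < z" "z < x" "F x - F b = (x - b) * \<phi> z" using MVT2 F by blast
    with assms(3) show ?thesis by simp
  qed simp
  have "(LBINT x. \<phi> x) = (LBINT x. \<phi> x * indicator {a..b} x)"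
  proof (rule Bochner_Integration.integral_cong)
    show "\<phi> x = \<phi> x * indicator {a..b} x" for x
      using assms(3)[of x] by (cases "x \<in> {a..b}") auto
  qed simp
  also have "\<dots> = F b - F a"
    by (rule integral_FTC_Icc_real) (use assms F cont in auto)
  finally have i: "(LBINT x. \<phi> x) = F b - F a" .
  show ?thesis
  proof (intro exI[of _ "\<lambda>x. F x - F a"] allI conjI impI)
    show "((\<lambda>x. F x - F a) has_real_derivative \<phi> x) (at x)" for x
      using F by (auto intro!: derivative_eq_intros)
    show "0 \<le> F x - F a" for x using l[of x] mono[of a x] by linarith
    show "F x - F a \<le> (LBINT x. \<phi> x)" for x using r[of x] mono[of x b] i by linarith
    show "F x - F a = 0" if "x \<le> a" for x using l[OF that] by simp
    show "F x - F a = (LBINT x. \<phi> x)" if "b \<le> x" for x using r[OF that] i by simp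
  qed
qed

subsection \<open>Sign of a function from its integrals against smooth functions\<close>

lemma open_eq_UN_intervals:
  fixes U :: "real set"
  assumes "open U"
  obtains c d :: "nat \<Rightarrow> real" where "U = (\<Union>i. {c i<..<d i})"
proof -
  obtain D where D: "countable D" "\<And>X. X \<in> D \<Longrightarrow> \<exists>a b. X = box a b" "\<Union>D = U"
    using open_countable_Union_open_box[OF assms] by metis
  \<comment> \<open>Adding the empty interval makes the family nonempty even if \<open>U\<close> is
    empty, so that \<open>from_nat_into\<close> enumerates it as a sequence.\<close>
  let ?D = "insert {} D"
  have cD: "countable ?D" "?D \<noteq> {}" using D by auto
  have "\<exists>a b::real. from_nat_into ?D i = {a<..<b}" for i
  proof -
    have "from_nat_into ?D i \<in> ?D" using cD(2) by (rule from_nat_into)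
    moreover have "{} = {0::real<..<0}" by auto
    ultimately show ?thesis using D(2) by (metis box_real(1) insertE)
  qed
  then obtain c d where cd: "\<And>i. from_nat_into ?D i = {c i<..<d i}" by metis
  have "U = \<Union>(range (from_nat_into ?D))"
    using D(3) range_from_nat_into[OF cD(2,1)] by auto
  then show ?thesis using that cd by auto
qed

text \<open>Smooth functions approximate indicators of open sets, so f has nonnegative integral over
  every open subset of the interval. Outer regularity of the measure |f| dx carries this over to the
  set where f is negative and forces its |f|-mass to be 0.\<close>

lemma AE_nonneg_if_integral_smooth_nonneg:
  fixes f :: "real \<Rightarrow> real"
  assumes int: "integrable lborel f"
    and out: "\<And>x. x \<notin> {a<..<b} \<Longrightarrow> f x = 0"
    and pos: "\<And>\<phi>. \<phi> \<in> smooth_alg \<Longrightarrow> (\<And>x. 0 \<le> \<phi> x) \<Longrightarrow> (\<And>x. x \<notin> {a<..<b} \<Longrightarrow> \<phi> x = 0) \<Longrightarrow>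
                0 \<le> (LBINT x. f x * \<phi> x)"
  shows "AE x in lborel. 0 \<le> f x"
proof -
  have [measurable]: "f \<in> borel_measurable borel" using int by auto
  have open_in: "0 \<le> (LBINT x. f x * indicator U x)" if U: "open U" "U \<subseteq> {a<..<b}" for U
  proof -
    obtain c d :: "nat \<Rightarrow> real" where cd: "U = (\<Union>i. {c i<..<d i})"
      using open_eq_UN_intervals[OF U(1)] .
    \<comment> \<open>A smooth union of the first \<open>k\<close> bumps with steepness
      \<open>k\<close>: it lies in [0,1], vanishes off \<open>U\<close>, and dominates each single
      bump with index below \<open>k\<close>, hence tends to 1 on \<open>U\<close>.\<close>
    define \<phi> where "\<phi> k x = 1 - (\<Prod>i<k. 1 - bump (real k) (c i) (d i) x)" for k x
    have sm: "\<phi> k \<in> smooth_alg" for k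
      unfolding \<phi>_def by (intro smooth_alg_diff smooth_alg.const smooth_alg_prod bump_smooth)
    have meas [measurable]: "\<phi> k \<in> borel_measurable borel" for k
      using smooth_alg_continuous_on[OF sm] by (rule borel_measurable_continuous_onI)
    have prod_bounds: "0 \<le> (\<Prod>i<k. 1 - bump (real k) (c i) (d i) x)"
                     "(\<Prod>i<k. 1 - bump (real k) (c i) (d i) x) \<le> 1" for k x
      by (auto intro!: prod_nonneg prod_le_1 simp: bump_bounds)
    have b: "0 \<le> \<phi> k x" "\<phi> k x \<le> 1" for k x
      using prod_bounds[where k=k and x=x] by (auto simp: \<phi>_def)
    have z: "\<phi> k x = 0" if "x \<notin> U" for k x
      using that cd by (auto simp: \<phi>_def bump_eq_0)
    have lim: "(\<lambda>k. \<phi> k x) \<longlonglongrightarrow> indicator U x" for x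
    proof (cases "x \<in> U")
      case True
      then obtain j where j: "x \<in> {c j<..<d j}" using cd by auto
      have le: "(\<Prod>i<k. 1 - bump (real k) (c i) (d i) x) \<le> 1 - bump (real k) (c j) (d j) x" if "j < k" for k
      proof -
        have "(\<Prod>i<k. 1 - bump (real k) (c i) (d i) x)
          = (1 - bump (real k) (c j) (d j) x) * (\<Prod>i\<in>{..<k}-{j}. 1 - bump (real k) (c i) (d i) x)"
          using that by (intro prod.remove) auto
        also have "\<dots> \<le> (1 - bump (real k) (c j) (d j) x) * 1"
          by (intro mult_left_mono prod_le_1) (auto simp: bump_bounds)
        finally show ?thesis by simp
      qed
      have "(\<lambda>k. \<phi> k x) \<longlonglongrightarrow> 1"
      proof (rule tendsto_sandwich)
        show "(\<lambda>k. bump (real k) (c j) (d j) x) \<longlonglongrightarrow> 1" by (rule bump_tendsto_1[OF j])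
        show "\<forall>\<^sub>F k in sequentially. bump (real k) (c j) (d j) x \<le> \<phi> k x"
          using eventually_gt_at_top[of j] by eventually_elim (use le in \<open>force simp: \<phi>_def\<close>)
        show "\<forall>\<^sub>F k in sequentially. \<phi> k x \<le> 1" by (simp add: b)
      qed auto
      with True show ?thesis by simp
    next
      case False
      then show ?thesis by (simp add: z)
    qed
    have "(\<lambda>k. LBINT x. f x * \<phi> k x) \<longlonglongrightarrow> (LBINT x. f x * indicator U x)"
    proof (rule integral_dominated_convergence[where w="\<lambda>x. \<bar>f x\<bar>"])
      show "AE x in lborel. (\<lambda>k. f x * \<phi> k x) \<longlonglongrightarrow> f x * indicator U x"
        by (intro AE_I2 tendsto_intros lim)
      show "AE x in lborel. norm (f x * \<phi> k x) \<le> \<bar>f x\<bar>" for k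
        by (intro AE_I2) (simp add: abs_mult b mult_left_le)
    qed (use int U in auto)
    moreover have "0 \<le> (LBINT x. f x * \<phi> k x)" for k
    proof (rule pos)
      show "\<phi> k x = 0" if "x \<notin> {a<..<b}" for x using z U(2) that by blast
    qed (use b sm in auto)
    ultimately show ?thesis by (meson LIMSEQ_le_const)
  qed
  define A where "A = {x. f x < 0}"
  have A[measurable]: "A \<in> sets borel" unfolding A_def by measurable
  have Aab: "A \<subseteq> {a<..<b}" using out unfolding A_def by force
  \<comment> \<open>Integrability of f makes \<open>N\<close> a finite Borel measure, which is what
    \<open>outer_regular\<close> asks for.\<close>
  define N where "N = density lborel (\<lambda>x. ennreal \<bar>f x\<bar>)"
  have sN: "sets N = sets borel" by (simp add: N_def)
  have eN: "emeasure N B = ennreal (LBINT x. \<bar>f x\<bar> * indicator B x)" if [measurable]: "B \<in> sets borel" for B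
  proof -
    have "emeasure N B = (\<integral>\<^sup>+x. ennreal (\<bar>f x\<bar> * indicator B x) \<partial>lborel)"
      unfolding N_def by (subst emeasure_density) (auto intro!: nn_integral_cong simp: indicator_def)
    also have "\<dots> = ennreal (LBINT x. \<bar>f x\<bar> * indicator B x)"
      using int by (intro nn_integral_eq_integral integrable_mult_indicator[where f="\<lambda>x. \<bar>f x\<bar>", simplified mult.commute real_scaleR_def]) auto
    finally show ?thesis .
  qed
  have ind: "integrable lborel (\<lambda>x. h x * indicator B x)" if "integrable lborel h" "B \<in> sets borel" for h :: "real \<Rightarrow> real" and B
    using integrable_mult_indicator[of B lborel h] that by (simp add: mult.commute)
  define I where "I = (LBINT x. \<bar>f x\<bar> * indicator A x)"
  have I0: "0 \<le> I" unfolding I_def by simp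
  have "I \<le> 0 + e" if "0 < e" for e
  proof -
    have fin: "emeasure N (space N) \<noteq> \<infinity>"
      using eN[of UNIV] by (simp add: N_def)
    have "emeasure N A = (INF U \<in> {U. A \<subseteq> U \<and> open U}. emeasure N U)"
      by (rule outer_regular[OF sN fin A])
    moreover have "emeasure N A < emeasure N A + ennreal e"
      using that eN[OF A] by (simp add: ennreal_less_iff flip: ennreal_plus)
    ultimately obtain U where U: "A \<subseteq> U" "open U" "emeasure N U < emeasure N A + ennreal e"
      by (metis (mono_tags, lifting) INF_less_iff mem_Collect_eq)
    \<comment> \<open>Intersecting with the interval keeps an open superset of \<open>A\<close> and
      brings it within reach of \<open>open_in\<close>.\<close>
    define W where "W = U \<inter> {a<..<b}"
    have W: "A \<subseteq> W" "open W" "W \<subseteq> {a<..<b}" "W \<subseteq> U" using U Aab by (auto simp: W_def)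
    have [measurable]: "W \<in> sets borel" "U \<in> sets borel" using W U by auto
    have "emeasure N W \<le> emeasure N U" using W(4) by (intro emeasure_mono) (auto simp: sN)
    with U(3) have "emeasure N W < emeasure N A + ennreal e" by simp
    then have lt: "(LBINT x. \<bar>f x\<bar> * indicator W x) < I + e"
      using that I0 unfolding I_def by (simp add: eN ennreal_less_iff flip: ennreal_plus)
    \<comment> \<open>On \<open>W\<close> the function f is |f| off \<open>A\<close> and -|f| on
      \<open>A\<close>. The integral is therefore below \<open>(I + e) - 2 * I = e - I\<close>, and
      being nonnegative it yields \<open>I \<le> e\<close>.\<close>
    have "(LBINT x. f x * indicator W x) = (LBINT x. \<bar>f x\<bar> * indicator W x - 2 * (\<bar>f x\<bar> * indicator A x))"
      by (rule Bochner_Integration.integral_cong) (use W(1) in \<open>auto simp: indicator_def A_def\<close>)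
    also have "\<dots> = (LBINT x. \<bar>f x\<bar> * indicator W x) - 2 * I"
      unfolding I_def using int by (subst Bochner_Integration.integral_diff) (auto intro!: ind integrable_mult_right)
    finally show ?thesis using open_in[OF W(2,3)] lt by simp
  qed
  then have "I = 0" using I0 by (meson field_le_epsilon order_antisym)
  then have "AE x in lborel. \<bar>f x\<bar> * indicator A x = 0"
    using integral_nonneg_eq_0_iff_AE[OF ind[of "\<lambda>x. \<bar>f x\<bar>" A]] int unfolding I_def by auto
  then show ?thesis
    by eventually_elim (auto simp: A_def indicator_def split: if_splits)
qed

subsection \<open>Weak derivatives\<close>

lemma integrable_mult_compact_support:
  fixes f u :: "real \<Rightarrow> real"
  assumes f: "locally_integrable f" and u: "continuous_on UNIV u" and out: "\<And>x. x \<notin> {a..b} \<Longrightarrow> u x = 0"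
  shows "integrable lborel (\<lambda>x. f x * u x)"
proof -
  have [measurable]: "f \<in> borel_measurable borel" "u \<in> borel_measurable borel"
    using f u by (auto simp: locally_integrable_def intro: borel_measurable_continuous_onI)
  have "bounded (u ` {a..b})"
    using u by (intro compact_imp_bounded compact_continuous_image) (auto intro: continuous_on_subset)
  then obtain M where M: "\<And>x. x \<in> {a..b} \<Longrightarrow> \<bar>u x\<bar> \<le> M"
    by (force simp: bounded_iff)
  have "integrable lborel (\<lambda>x. M * (indicator {a..b} x *\<^sub>R f x))"
    using f by (intro integrable_mult_right) (auto simp: locally_integrable_def set_integrable_def)
  then show ?thesis
  proof (rule Bochner_Integration.integrable_bound)
    show "AE x in lborel. norm (f x * u x) \<le> norm (M * (indicator {a..b} x *\<^sub>R f x))"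
    proof (rule AE_I2)
      fix x show "norm (f x * u x) \<le> norm (M * (indicator {a..b} x *\<^sub>R f x))"
      proof (cases "x \<in> {a..b}")
        case True
        then have "\<bar>u x\<bar> * \<bar>f x\<bar> \<le> \<bar>M\<bar> * \<bar>f x\<bar>" using M[of x] by (intro mult_right_mono) auto
        with True show ?thesis by (simp add: abs_mult mult.commute)
      qed (use out in auto)
    qed
  qed measurable
qed

lemma locally_integrable_const: "locally_integrable (\<lambda>_. c)"
  using borel_integrable_compact[OF _ continuous_on_const[of _ c]]
  by (auto simp: locally_integrable_def set_integrable_def)

lemma locally_integrable_add:
  assumes "locally_integrable f" "locally_integrable g"
  shows "locally_integrable (\<lambda>x. f x + g x)"
  using assms unfolding locally_integrable_def
  by (intro conjI allI impI borel_measurable_add set_integral_add(1)) blast+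

lemma locally_integrable_uminus:
  assumes "locally_integrable f"
  shows "locally_integrable (\<lambda>x. - f x)"
  using assms by (auto simp: locally_integrable_def set_integrable_def)

lemma locally_integrable_restrict:
  assumes "locally_integrable f"
  shows "integrable lborel (\<lambda>x. f x * indicator {a<..<b} x)"
proof -
  have "set_integrable lborel {a..b} f" using assms by (auto simp: locally_integrable_def)
  then have "set_integrable lborel {a<..<b} f" by (rule set_integrable_subset) auto
  then show ?thesis by (simp add: set_integrable_def mult.commute)
qed

section \<open>Test functions and integration against them\<close>

lemma test_functions_support:
  assumes "\<eta> \<in> test_functions"
  obtains a b where "a \<le> b" "\<And>x. x \<notin> {a..b} \<Longrightarrow> \<eta> x = 0" "\<And>x. x \<notin> {a..b} \<Longrightarrow> deriv \<eta> x = 0"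
proof -
  have "bounded (closure {x. \<eta> x \<noteq> 0})"
    using assms by (auto simp: test_functions_def intro: compact_imp_bounded)
  then obtain R where R: "\<And>x. x \<in> closure {x. \<eta> x \<noteq> 0} \<Longrightarrow> \<bar>x\<bar> \<le> R"
    by (auto simp: bounded_iff)
  \<comment> \<open>The bound \<open>R\<close> may be negative when the support is empty; its
    absolute value guarantees a nonempty interval.\<close>
  have 0: "\<eta> x = 0" if "x \<notin> {-\<bar>R\<bar>..\<bar>R\<bar>}" for x
    using R[of x] that closure_subset[of "{x. \<eta> x \<noteq> 0}"] by force
  have 1: "deriv \<eta> x = 0" if "x \<notin> {-\<bar>R\<bar>..\<bar>R\<bar>}" for x
  proof -
    have "open (- {-\<bar>R\<bar>..\<bar>R\<bar>})" by (intro open_Compl) auto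
    have "((\<lambda>_. 0) has_real_derivative 0) (at x)" by simp
    then have "(\<eta> has_real_derivative 0) (at x)"
      by (rule has_field_derivative_transform_within_open[where S="- {-\<bar>R\<bar>..\<bar>R\<bar>}"])
         (use that 0 \<open>open _\<close> in auto)
    then show ?thesis by (rule DERIV_imp_deriv)
  qed
  show ?thesis by (rule that[of "-\<bar>R\<bar>" "\<bar>R\<bar>"]) (use 0 1 in auto)
qed

lemma test_functions_DERIV:
  assumes "\<eta> \<in> test_functions"
  shows "(\<eta> has_real_derivative deriv \<eta> x) (at x)"
proof -
  have "(deriv ^^ 0) \<eta> differentiable at x" using assms unfolding test_functions_def by blast
  then show ?thesis by (simp add: DERIV_deriv_iff_real_differentiable)
qed

lemma test_functions_deriv_isCont:
  assumes "\<eta> \<in> test_functions"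
  shows "isCont (deriv \<eta>) x"
proof -
  have "(deriv ^^ 1) \<eta> differentiable at x" using assms unfolding test_functions_def by blast
  then show ?thesis by (simp add: differentiable_imp_continuous_within)
qed

lemma test_functions_continuous_on:
  assumes "\<eta> \<in> test_functions"
  shows "continuous_on S \<eta>" "continuous_on S (deriv \<eta>)"
  using DERIV_isCont[OF test_functions_DERIV[OF assms]] test_functions_deriv_isCont[OF assms]
  by (auto intro!: continuous_at_imp_continuous_on)

lemma integrable_mult_test_function:
  assumes "locally_integrable f" "\<eta> \<in> test_functions"
  shows "integrable lborel (\<lambda>x. f x * \<eta> x)" "integrable lborel (\<lambda>x. f x * deriv \<eta> x)"
  using test_functions_support[OF assms(2)] test_functions_continuous_on[OF assms(2)]
    integrable_mult_compact_support[OF assms(1)] by metis+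

lemma integral_deriv_test_function:
  assumes "\<eta> \<in> test_functions"
  shows "(LBINT x. deriv \<eta> x) = 0"
proof -
  obtain a b where ab: "a \<le> b" "\<And>x. x \<notin> {a..b} \<Longrightarrow> \<eta> x = 0" "\<And>x. x \<notin> {a..b} \<Longrightarrow> deriv \<eta> x = 0"
    using test_functions_support[OF assms] by blast
  \<comment> \<open>\<open>\<eta>\<close> is known to vanish only outside \<open>{a..b}\<close>, so
    the interval is enlarged by 1 to put both endpoints there.\<close>
  have "(LBINT x. deriv \<eta> x) = (LBINT x. deriv \<eta> x * indicator {a - 1..b + 1} x)"
  proof (rule Bochner_Integration.integral_cong)
    show "deriv \<eta> x = deriv \<eta> x * indicator {a - 1..b + 1} x" for x
      using ab(3)[of x] by (cases "x \<in> {a - 1..b + 1}") auto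
  qed simp
  also have "\<dots> = \<eta> (b + 1) - \<eta> (a - 1)"
    using ab test_functions_DERIV[OF assms] test_functions_deriv_isCont[OF assms]
    by (intro integral_FTC_Icc_real) auto
  finally show ?thesis using ab by simp
qed

text \<open>The constant contributes c times the integral of \<open>deriv \<eta>\<close>, which is 0
  because \<open>\<eta>\<close> has compact support.\<close>

lemma has_weak_derivative_const_add_iff:
  "has_weak_derivative (\<lambda>x. c + f x) g \<longleftrightarrow> has_weak_derivative f g"
proof -
  have li: "locally_integrable (\<lambda>x. c + f x) \<longleftrightarrow> locally_integrable f"
    using locally_integrable_add[OF locally_integrable_const[of c], of f]
      locally_integrable_add[OF locally_integrable_const[of "-c"], of "\<lambda>x. c + f x"] by auto
  have "(LBINT x. (c + f x) * deriv \<eta> x) = (LBINT x. f x * deriv \<eta> x)"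
    if "locally_integrable f" "\<eta> \<in> test_functions" for \<eta>
  proof -
    have "(LBINT x. (c + f x) * deriv \<eta> x) = (LBINT x. c * deriv \<eta> x + f x * deriv \<eta> x)"
      by (simp add: algebra_simps)
    also have "\<dots> = (LBINT x. c * deriv \<eta> x) + (LBINT x. f x * deriv \<eta> x)"
      using that by (intro Bochner_Integration.integral_add integrable_mult_test_function locally_integrable_const)
    finally show ?thesis by (simp add: integral_deriv_test_function that)
  qed
  with li show ?thesis unfolding has_weak_derivative_def by (auto cong: conj_cong)
qed

text \<open>Both sides choose from the same predicate, so they agree as functions and not merely
  almost everywhere. This replaces the weak derivative of \<open>1 + p\<close> by that of p in the
  energy.\<close>

lemma weak_deriv_const_add: "weak_deriv (\<lambda>x. c + f x) = weak_deriv f"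
  by (simp add: weak_deriv_def has_weak_derivative_const_add_iff)

section \<open>Local sign criteria and uniqueness of weak derivatives\<close>

lemma AE_if_AE_on_intervals:
  assumes "\<And>y::real. AE x in lborel. x \<in> {y - 1<..<y + 1} \<longrightarrow> P x"
  shows "AE x in lborel. P x"
proof -
  \<comment> \<open>Countably many intervals of length 2 with integer centres cover the line, so the
    exceptional null sets can be united.\<close>
  have "AE x in lborel. \<forall>k::int. x \<in> {of_int k - 1<..<of_int k + 1} \<longrightarrow> P x"
    using assms by (subst AE_all_countable) auto
  then show ?thesis
  proof eventually_elim
    case (elim x)
    have "x \<in> {of_int \<lfloor>x\<rfloor> - 1<..<of_int \<lfloor>x\<rfloor> + 1}" by (auto; linarith)
    with elim show ?case by blast
  qed
qed

lemma smooth_alg_test_function: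
  assumes "\<phi> \<in> smooth_alg" "\<And>x. x \<notin> {a<..<b} \<Longrightarrow> \<phi> x = 0"
  shows "\<phi> \<in> test_functions"
proof -
  have "deriv \<phi> \<in> smooth_alg" by (rule smooth_alg_deriv[OF assms(1)])
  moreover have "(\<phi> has_real_derivative deriv \<phi> x) (at x)" for x
    using smooth_alg_differentiable[OF assms(1)] by (simp add: DERIV_deriv_iff_real_differentiable)
  ultimately show ?thesis using assms(2)
    by (intro antiderivative_in_test_functions[where a=a and b=b]) auto
qed

lemma AE_nonneg_on_interval:
  assumes f: "locally_integrable f"
    and pos: "\<And>\<phi>. \<phi> \<in> smooth_alg \<Longrightarrow> (\<And>x. 0 \<le> \<phi> x) \<Longrightarrow> (\<And>x. x \<notin> {a<..<b} \<Longrightarrow> \<phi> x = 0) \<Longrightarrow>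
                0 \<le> (LBINT x. f x * \<phi> x)"
  shows "AE x in lborel. x \<in> {a<..<b} \<longrightarrow> 0 \<le> f x"
proof -
  have "AE x in lborel. 0 \<le> f x * indicator {a<..<b} x"
  proof (rule AE_nonneg_if_integral_smooth_nonneg[where a=a and b=b])
    show "integrable lborel (\<lambda>x. f x * indicator {a<..<b} x)" by (rule locally_integrable_restrict[OF f])
    fix \<phi> assume \<phi>: "\<phi> \<in> smooth_alg" "\<And>x. 0 \<le> \<phi> x" "\<And>x. x \<notin> {a<..<b} \<Longrightarrow> \<phi> x = 0"
    have "(\<lambda>x. f x * indicator {a<..<b} x * \<phi> x) = (\<lambda>x. f x * \<phi> x)"
    proof
      show "f x * indicator {a<..<b} x * \<phi> x = f x * \<phi> x" for x
        using \<phi>(3)[of x] by (cases "x \<in> {a<..<b}") auto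
    qed
    then show "0 \<le> (LBINT x. f x * indicator {a<..<b} x * \<phi> x)" using pos[OF \<phi>] by simp
  qed auto
  then show ?thesis by eventually_elim auto
qed

text \<open>The difference of two weak derivatives annihilates every test function, so the sign
  criterion applies to the difference and to its negative.\<close>

lemma has_weak_derivative_unique:
  assumes g: "has_weak_derivative f g" and h: "has_weak_derivative f h"
  shows "AE x in lborel. g x = h x"
proof (rule AE_if_AE_on_intervals)
  fix y :: real
  have eq: "(LBINT x. (u x + - v x) * \<phi> x) = 0"
    if uv: "has_weak_derivative f u" "has_weak_derivative f v" and \<phi>: "\<phi> \<in> test_functions" for u v \<phi>
  proof -
    have "integrable lborel (\<lambda>x. u x * \<phi> x)" "integrable lborel (\<lambda>x. v x * \<phi> x)"
      using uv \<phi> integrable_mult_test_function by (auto simp: has_weak_derivative_def)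
    then have "(LBINT x. (u x + - v x) * \<phi> x) = (LBINT x. u x * \<phi> x) - (LBINT x. v x * \<phi> x)"
      by (simp add: left_diff_distrib)
    moreover have "- (LBINT x. u x * \<phi> x) = - (LBINT x. v x * \<phi> x)"
      using uv \<phi> unfolding has_weak_derivative_def by metis
    ultimately show ?thesis by simp
  qed
  have nn: "AE x in lborel. x \<in> {y - 1<..<y + 1} \<longrightarrow> 0 \<le> u x + - v x"
    if "has_weak_derivative f u" "has_weak_derivative f v" for u v
  proof (rule AE_nonneg_on_interval)
    show "locally_integrable (\<lambda>x. u x + - v x)"
      using that by (intro locally_integrable_add locally_integrable_uminus) (auto simp: has_weak_derivative_def)
    show "0 \<le> (LBINT x. (u x + - v x) * \<phi> x)"
      if "\<phi> \<in> smooth_alg" "\<And>x. x \<notin> {y - 1<..<y + 1} \<Longrightarrow> \<phi> x = 0" for \<phi>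
      using eq[OF \<open>has_weak_derivative f u\<close> \<open>has_weak_derivative f v\<close> smooth_alg_test_function[OF that]] by simp
  qed
  note nn[OF g h] nn[OF h g]
  then show "AE x in lborel. x \<in> {y - 1<..<y + 1} \<longrightarrow> g x = h x"
    by eventually_elim auto
qed

subsection \<open>The sup bound\<close>

text \<open>The inequality \<open>2 * \<bar>f x\<bar> * N \<le> (f x)^2 + N^2\<close> is used in
  place of Cauchy-Schwarz. After division by \<open>2 * N\<close>, the quadratic term integrates to
  at most \<open>N / 2\<close>, and the constant \<open>N / 2\<close> over an interval of length 2
  gives \<open>N\<close>.\<close>

lemma integral_abs_interval_le:
  fixes f :: "real \<Rightarrow> real"
  assumes f: "integrable lborel (\<lambda>x. (f x)\<^sup>2)" "locally_integrable f"
    and N: "0 < N" "(LBINT x. (f x)\<^sup>2) \<le> N\<^sup>2"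
  shows "(LBINT x. \<bar>f x\<bar> * indicator {y - 1<..<y + 1} x) \<le> 3 / 2 * N"
proof -
  let ?I = "\<lambda>x. indicator {y - 1<..<y + 1} x :: real"
  have i1: "integrable lborel (\<lambda>x. \<bar>f x\<bar> * ?I x)"
    using integrable_abs[OF locally_integrable_restrict[OF f(2), of "y - 1" "y + 1"]] by (simp add: abs_mult)
  have "(LBINT x. \<bar>f x\<bar> * ?I x) \<le> (LBINT x. (f x)\<^sup>2 / (2 * N) + N / 2 * ?I x)"
  proof (rule integral_mono)
    fix x
    have "2 * (\<bar>f x\<bar> * N) \<le> (f x)\<^sup>2 + N\<^sup>2"
      using sum_squares_bound[of "\<bar>f x\<bar>" N] by simp
    then have "\<bar>f x\<bar> \<le> (f x)\<^sup>2 / (2 * N) + N / 2"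
      using N by (simp add: field_simps power2_eq_square)
    moreover have "0 \<le> (f x)\<^sup>2 / (2 * N)" using N by simp
    ultimately show "\<bar>f x\<bar> * ?I x \<le> (f x)\<^sup>2 / (2 * N) + N / 2 * ?I x"
      by (auto simp: indicator_def)
  qed (use f i1 in auto)
  also have "\<dots> = (LBINT x. (f x)\<^sup>2) / (2 * N) + N"
    using f by (subst Bochner_Integration.integral_add) auto
  also have "\<dots> \<le> N\<^sup>2 / (2 * N) + N"
    using N by (intro add_right_mono divide_right_mono) auto
  also have "\<dots> = 3 / 2 * N" using N by (simp add: field_simps power2_eq_square)
  finally show ?thesis .
qed

text \<open>Intended for two pairings: p with the unit-mass bump, where \<open>M\<close> is the
  bound of the bump, and the weak derivative with the compactly supported antiderivative, where
  \<open>M\<close> is the mass of \<open>\<phi>\<close>.\<close>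

lemma abs_integral_mult_le:
  fixes f u :: "real \<Rightarrow> real"
  assumes f: "integrable lborel (\<lambda>x. (f x)\<^sup>2)" "locally_integrable f"
    and N: "0 < N" "(LBINT x. (f x)\<^sup>2) \<le> N\<^sup>2"
    and u: "\<And>x. \<bar>u x\<bar> \<le> M" "\<And>x. x \<notin> {y - 1<..<y + 1} \<Longrightarrow> u x = 0"
  shows "\<bar>LBINT x. f x * u x\<bar> \<le> M * (3 / 2 * N)"
proof -
  let ?I = "\<lambda>x. indicator {y - 1<..<y + 1} x :: real"
  have M: "0 \<le> M" using u(1)[of 0] by linarith
  have i1: "integrable lborel (\<lambda>x. \<bar>f x\<bar> * ?I x)"
    using integrable_abs[OF locally_integrable_restrict[OF f(2), of "y - 1" "y + 1"]] by (simp add: abs_mult)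
  have "norm (LBINT x. f x * u x) \<le> (LBINT x. norm (f x * u x))"
    by (rule integral_norm_bound)
  also have "\<dots> \<le> (LBINT x. M * (\<bar>f x\<bar> * ?I x))"
  proof (rule integral_mono')
    show "norm (f x * u x) \<le> M * (\<bar>f x\<bar> * ?I x)" for x
    proof (cases "x \<in> {y - 1<..<y + 1}")
      case True
      then show ?thesis using mult_left_mono[OF u(1)[of x], of "\<bar>f x\<bar>"] by (simp add: abs_mult mult.commute)
    qed (simp add: u(2))
  qed (use i1 M in auto)
  also have "\<dots> = M * (LBINT x. \<bar>f x\<bar> * ?I x)" by simp
  also have "\<dots> \<le> M * (3 / 2 * N)"
    using integral_abs_interval_le[OF f N] M by (rule mult_left_mono)
  finally show ?thesis by simp
qed

text \<open>All \<open>\<rho> y\<close> are translates of one normalised bump, which makes the bound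
  \<open>R\<close> independent of the centre \<open>y\<close>. The final Sobolev constant inherits
  this uniformity.\<close>

lemma unit_mass_bumps:
  obtains R :: real and \<rho> :: "real \<Rightarrow> real \<Rightarrow> real" where
    "\<And>y. \<rho> y \<in> smooth_alg" "\<And>y x. 0 \<le> \<rho> y x" "\<And>y x. \<rho> y x \<le> R"
    "\<And>y x. x \<notin> {y - 1<..<y + 1} \<Longrightarrow> \<rho> y x = 0" "\<And>y. (LBINT x. \<rho> y x) = 1"
proof -
  have m: "bump 1 c d \<in> borel_measurable borel" for c d
    using smooth_alg_continuous_on[OF bump_smooth] by (rule borel_measurable_continuous_onI)
  define J where "J = (LBINT x. bump 1 (-1) 1 x)"
  have i: "integrable lborel (bump 1 (-1) 1)"
  proof (rule Bochner_Integration.integrable_bound)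
    show "integrable lborel (indicator {-1..1} :: real \<Rightarrow> real)" by auto
    show "AE x in lborel. norm (bump 1 (-1) 1 x) \<le> norm (indicator {-1..1} x :: real)"
    proof (rule AE_I2)
      show "norm (bump 1 (-1) 1 x) \<le> norm (indicator {-1..1} x :: real)" for x :: real
        using bump_bounds[of 1 "-1" 1 x] bump_eq_0[of 1 x "-1" 1] by (cases "x \<in> {-1..1}") auto
    qed
  qed (use m in auto)
  \<comment> \<open>A vanishing integral would make the bump zero almost everywhere, although it is
    positive on an interval of positive measure.\<close>
  have "J \<noteq> 0"
  proof
    assume "J = 0"
    then have "AE x in lborel. bump 1 (-1) 1 x = 0"
      using integral_nonneg_eq_0_iff_AE[OF i] by (simp add: bump_bounds J_def)
    then have "AE x in lborel. x \<notin> {-1<..<1::real}"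
      by eventually_elim (use bump_pos[of 1 _ "-1" 1] in force)
    then have "{-1<..<1::real} \<in> null_sets lborel"
      by (intro AE_iff_null_sets[THEN iffD2]) auto
    then show False by (auto simp: null_sets_def)
  qed
  moreover have "0 \<le> J" unfolding J_def by (simp add: bump_bounds)
  ultimately have J: "J > 0" by simp
  have tr: "bump 1 (y - 1) (y + 1) x = bump 1 (-1) 1 (- y + x)" for x y
    by (simp add: bump_def algebra_simps)
  have "(LBINT x. bump 1 (y - 1) (y + 1) x) = J" for y
    unfolding tr J_def using lborel_integral_real_affine[of 1 "bump 1 (-1) 1" "-y"] by simp
  moreover have "(\<lambda>x. (1 / J) * bump 1 (y - 1) (y + 1) x) \<in> smooth_alg" for y
    by (intro smooth_alg.mult smooth_alg.const bump_smooth)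
  ultimately show ?thesis using J
    by (intro that[of "\<lambda>y x. (1 / J) * bump 1 (y - 1) (y + 1) x" "1 / J"])
       (auto intro!: bump_eq_0 divide_right_mono
             simp: bump_bounds)
qed

lemma smooth_alg_integrable:
  assumes "\<phi> \<in> smooth_alg" "\<And>x. x \<notin> {a<..<b} \<Longrightarrow> \<phi> x = 0"
  shows "integrable lborel \<phi>"
  using integrable_mult_test_function(1)[OF locally_integrable_const[of 1] smooth_alg_test_function[OF assms]]
  by simp

text \<open>The antiderivative of \<open>\<phi> - (\<integral>\<phi>) \<rho>\<close>, where \<open>\<rho>\<close> has unit mass, is a test function bounded by
  \<open>\<integral>\<phi>\<close>. Testing the weak derivative with it bounds \<open>\<integral>p \<phi>\<close> by a multiple of \<open>\<integral>\<phi>\<close>.\<close>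

lemma sobolev_sup_bound_pos:
  obtains C where "0 \<le> C" "\<And>p g N. has_weak_derivative p g \<Longrightarrow>
      integrable lborel (\<lambda>x. (p x)\<^sup>2) \<Longrightarrow> integrable lborel (\<lambda>x. (g x)\<^sup>2) \<Longrightarrow> 0 < N \<Longrightarrow>
      (LBINT x. (p x)\<^sup>2) \<le> N\<^sup>2 \<Longrightarrow> (LBINT x. (g x)\<^sup>2) \<le> N\<^sup>2 \<Longrightarrow> AE x in lborel. \<bar>p x\<bar> \<le> C * N"
proof -
  obtain R :: real and \<rho> :: "real \<Rightarrow> real \<Rightarrow> real" where
    \<rho>: "\<And>y. \<rho> y \<in> smooth_alg" "\<And>y x. 0 \<le> \<rho> y x" "\<And>y x. \<rho> y x \<le> R"
    "\<And>y x. x \<notin> {y - 1<..<y + 1} \<Longrightarrow> \<rho> y x = 0" "\<And>y. (LBINT x. \<rho> y x) = 1"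
    using unit_mass_bumps by metis
  have R: "0 \<le> R" using \<rho>(2,3)[of 0 0] by linarith
  \<comment> \<open>The summand with \<open>R\<close> pays for the pairing of p with
    \<open>\<rho> y\<close>, the summand 1 for the pairing of g with the antiderivative;
    \<open>3 / 2\<close> comes from the local L1 bound.\<close>
  define C where "C = 3 / 2 * (R + 1)"
  have "AE x in lborel. \<bar>p x\<bar> \<le> C * N"
    if wd: "has_weak_derivative p g" and p2: "integrable lborel (\<lambda>x. (p x)\<^sup>2)"
      and g2: "integrable lborel (\<lambda>x. (g x)\<^sup>2)" and N: "0 < N"
      and pN: "(LBINT x. (p x)\<^sup>2) \<le> N\<^sup>2" and gN: "(LBINT x. (g x)\<^sup>2) \<le> N\<^sup>2" for p g N
  proof (rule AE_if_AE_on_intervals)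
    fix y :: real
    have li: "locally_integrable p" "locally_integrable g" using wd by (auto simp: has_weak_derivative_def)
    have main: "integrable lborel \<phi> \<and> integrable lborel (\<lambda>x. p x * \<phi> x) \<and>
        \<bar>LBINT x. p x * \<phi> x\<bar> \<le> C * N * (LBINT x. \<phi> x)"
      if \<phi>: "\<phi> \<in> smooth_alg" "\<And>x. 0 \<le> \<phi> x" "\<And>x. x \<notin> {y - 1<..<y + 1} \<Longrightarrow> \<phi> x = 0" for \<phi>
    proof -
      define m where "m = (LBINT x. \<phi> x)"
      have m: "0 \<le> m" using \<phi>(2) by (simp add: m_def)
      have le: "y - 1 \<le> y + 1" by simp
      obtain \<Phi> where "\<forall>x. (\<Phi> has_real_derivative \<phi> x) (at x) \<and> (x \<le> y - 1 \<longrightarrow> \<Phi> x = 0) \<and>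
          (y + 1 \<le> x \<longrightarrow> \<Phi> x = m) \<and> 0 \<le> \<Phi> x \<and> \<Phi> x \<le> m"
        using antiderivative_bounds[OF \<phi> le] unfolding m_def by blast
      then have \<Phi>: "\<And>x. (\<Phi> has_real_derivative \<phi> x) (at x)"
        "\<And>x. x \<le> y - 1 \<Longrightarrow> \<Phi> x = 0" "\<And>x. y + 1 \<le> x \<Longrightarrow> \<Phi> x = m"
        "\<And>x. 0 \<le> \<Phi> x" "\<And>x. \<Phi> x \<le> m" by blast+
      obtain P where "\<forall>x. (P has_real_derivative \<rho> y x) (at x) \<and> (x \<le> y - 1 \<longrightarrow> P x = 0) \<and>
          (y + 1 \<le> x \<longrightarrow> P x = 1) \<and> 0 \<le> P x \<and> P x \<le> 1"
        using antiderivative_bounds[OF \<rho>(1,2,4) le] unfolding \<rho>(5) by blast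
      then have P: "\<And>x. (P has_real_derivative \<rho> y x) (at x)"
        "\<And>x. x \<le> y - 1 \<Longrightarrow> P x = 0" "\<And>x. y + 1 \<le> x \<Longrightarrow> P x = 1"
        "\<And>x. 0 \<le> P x" "\<And>x. P x \<le> 1" by blast+
      \<comment> \<open>Right of the interval both terms equal \<open>m\<close>, so
        \<open>\<eta>\<close> has compact support. Everywhere both lie between 0 and
        \<open>m\<close>, hence so does the absolute value of their difference.\<close>
      define \<eta> where "\<eta> x = \<Phi> x - m * P x" for x
      have \<eta>0: "\<eta> x = 0" if "x \<notin> {y - 1<..<y + 1}" for x
        using that \<Phi>(2,3) P(2,3) by (cases "x \<le> y - 1") (auto simp: \<eta>_def)
      have "(\<lambda>x. \<phi> x - m * \<rho> y x) \<in> smooth_alg"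
        using \<phi> \<rho> by (intro smooth_alg_diff smooth_alg.mult smooth_alg.const)
      moreover have "(\<eta> has_real_derivative \<phi> x - m * \<rho> y x) (at x)" for x
        unfolding \<eta>_def using \<Phi>(1) P(1) by (auto intro!: derivative_eq_intros)
      ultimately have \<eta>: "\<eta> \<in> test_functions" "deriv \<eta> = (\<lambda>x. \<phi> x - m * \<rho> y x)"
        using \<eta>0 by (auto intro!: antiderivative_in_test_functions[where a="y - 1" and b="y + 1"])
      have "\<bar>\<eta> x\<bar> \<le> m" for x
      proof -
        have "m * P x \<le> m * 1" using m P(5) by (intro mult_left_mono)
        moreover have "0 \<le> m * P x" using m P(4) by simp
        ultimately show ?thesis using \<Phi>(4,5)[of x] by (simp add: \<eta>_def)
      qed
      then have g\<eta>: "\<bar>LBINT x. g x * \<eta> x\<bar> \<le> m * (3 / 2 * N)"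
        using \<eta>0 by (intro abs_integral_mult_le[OF g2 li(2) N gN])
      have p\<rho>: "\<bar>LBINT x. p x * \<rho> y x\<bar> \<le> R * (3 / 2 * N)"
        using \<rho>(2,3,4) by (intro abs_integral_mult_le[OF p2 li(1) N pN, of _ _ y]) auto
      have ip: "integrable lborel (\<lambda>x. p x * \<phi> x)" "integrable lborel (\<lambda>x. p x * \<rho> y x)"
        using smooth_alg_test_function[OF \<phi>(1,3)] smooth_alg_test_function[OF \<rho>(1,4)]
          integrable_mult_test_function(1)[OF li(1)] by blast+
      have "(LBINT x. p x * (\<phi> x - m * \<rho> y x)) = - (LBINT x. g x * \<eta> x)"
        using wd \<eta> unfolding has_weak_derivative_def by metis
      moreover have "(LBINT x. p x * (\<phi> x - m * \<rho> y x)) = (LBINT x. p x * \<phi> x - m * (p x * \<rho> y x))"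
        by (simp add: algebra_simps)
      moreover have "\<dots> = (LBINT x. p x * \<phi> x) - m * (LBINT x. p x * \<rho> y x)"
        using ip by simp
      ultimately have "(LBINT x. p x * \<phi> x) = m * (LBINT x. p x * \<rho> y x) - (LBINT x. g x * \<eta> x)"
        by simp
      also have "\<bar>\<dots>\<bar> \<le> m * (R * (3 / 2 * N)) + m * (3 / 2 * N)"
        using g\<eta> mult_left_mono[OF p\<rho> m] m abs_mult[of m "LBINT x. p x * \<rho> y x"] by linarith
      also have "\<dots> = C * N * m" by (simp add: C_def algebra_simps)
      finally show ?thesis using ip(1) smooth_alg_integrable[OF \<phi>(1,3)] unfolding m_def by blast
    qed
    \<comment> \<open>The two signs \<open>s = 1\<close> and \<open>s = -1\<close> turn the bound on
      the pairing into nonnegativity of \<open>C * N + p\<close> and \<open>C * N - p\<close>, to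
      which the sign criterion applies.\<close>
    have nn: "AE x in lborel. x \<in> {y - 1<..<y + 1} \<longrightarrow> 0 \<le> C * N + s * p x" if s: "\<bar>s\<bar> = 1" for s
    proof (rule AE_nonneg_on_interval)
      have s': "s = 1 \<or> s = -1" using s by (auto simp: abs_if split: if_splits)
      show "locally_integrable (\<lambda>x. C * N + s * p x)"
        using s' li(1) locally_integrable_uminus[OF li(1)]
        by (intro locally_integrable_add locally_integrable_const) auto
      fix \<phi> assume \<phi>: "\<phi> \<in> smooth_alg" "\<And>x. 0 \<le> \<phi> x" "\<And>x. x \<notin> {y - 1<..<y + 1} \<Longrightarrow> \<phi> x = 0"
      note M = main[OF \<phi>]
      have "(LBINT x. (C * N + s * p x) * \<phi> x) = (LBINT x. C * N * \<phi> x + s * (p x * \<phi> x))"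
        by (simp add: algebra_simps)
      also have "\<dots> = C * N * (LBINT x. \<phi> x) + s * (LBINT x. p x * \<phi> x)"
        using M by (subst Bochner_Integration.integral_add) auto
      also have "\<dots> \<ge> 0" using M s' by auto
      finally show "0 \<le> (LBINT x. (C * N + s * p x) * \<phi> x)" .
    qed
    show "AE x in lborel. x \<in> {y - 1<..<y + 1} \<longrightarrow> \<bar>p x\<bar> \<le> C * N"
      using nn[of 1] nn[of "-1"] by (auto elim: eventually_elim2)
  qed
  moreover have "0 \<le> C" using R by (simp add: C_def)
  ultimately show ?thesis using that by blast
qed

subsection \<open>Expansion of the energy\<close>

text \<open>This adds the case \<open>N = 0\<close>, needed because \<open>H1_to_zero\<close> also
  sees functions of norm 0. The bound for positive radii is applied to
  \<open>N + 1 / (k + 1)\<close> for all k simultaneously, and k tends to infinity off one null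
  set.\<close>

lemma sobolev_sup_bound:
  "\<exists>C\<ge>0. \<forall>p g N. has_weak_derivative p g \<and>
      integrable lborel (\<lambda>x. (p x)\<^sup>2) \<and> integrable lborel (\<lambda>x. (g x)\<^sup>2) \<and> 0 \<le> N \<and>
      (LBINT x. (p x)\<^sup>2) \<le> N\<^sup>2 \<and> (LBINT x. (g x)\<^sup>2) \<le> N\<^sup>2 \<longrightarrow> (AE x in lborel. \<bar>p x\<bar> \<le> C * N)"
proof -
  obtain C where C: "0 \<le> C" "\<And>p g N. has_weak_derivative p g \<Longrightarrow>
      integrable lborel (\<lambda>x. (p x)\<^sup>2) \<Longrightarrow> integrable lborel (\<lambda>x. (g x)\<^sup>2) \<Longrightarrow> 0 < N \<Longrightarrow>
      (LBINT x. (p x)\<^sup>2) \<le> N\<^sup>2 \<Longrightarrow> (LBINT x. (g x)\<^sup>2) \<le> N\<^sup>2 \<Longrightarrow> AE x in lborel. \<bar>p x\<bar> \<le> C * N"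
    using sobolev_sup_bound_pos by blast
  show ?thesis
  proof (intro exI[of _ C] conjI allI impI C(1); elim conjE)
    fix p g :: "real \<Rightarrow> real" and N :: real
    assume a: "has_weak_derivative p g" "integrable lborel (\<lambda>x. (p x)\<^sup>2)" "integrable lborel (\<lambda>x. (g x)\<^sup>2)"
      "0 \<le> N" "(LBINT x. (p x)\<^sup>2) \<le> N\<^sup>2" "(LBINT x. (g x)\<^sup>2) \<le> N\<^sup>2"
    have "AE x in lborel. \<bar>p x\<bar> \<le> C * (N + inverse (real (Suc k)))" for k
    proof (rule C(2)[OF a(1-3)])
      have "N\<^sup>2 \<le> (N + inverse (real (Suc k)))\<^sup>2" using a(4) by (intro power_mono) auto
      then show "(LBINT x. (p x)\<^sup>2) \<le> (N + inverse (real (Suc k)))\<^sup>2"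
        "(LBINT x. (g x)\<^sup>2) \<le> (N + inverse (real (Suc k)))\<^sup>2" using a(5,6) by linarith+
    qed (use a(4) in \<open>auto intro: add_nonneg_pos\<close>)
    then have "AE x in lborel. \<forall>k. \<bar>p x\<bar> \<le> C * (N + inverse (real (Suc k)))"
      by (simp add: AE_all_countable)
    then show "AE x in lborel. \<bar>p x\<bar> \<le> C * N"
    proof eventually_elim
      case (elim x)
      have "(\<lambda>k. C * (N + inverse (real (Suc k)))) \<longlonglongrightarrow> C * (N + 0)"
        by (intro tendsto_intros LIMSEQ_inverse_real_of_nat)
      then show ?case using elim by (intro LIMSEQ_le_const) auto
    qed
  qed
qed

section \<open>Taylor estimates at 1 for the weight and the potential\<close>

lemma taylor_remainder_bound:
  fixes diff :: "nat \<Rightarrow> real \<Rightarrow> real"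
  assumes "0 < k" "0 \<le> r"
    and D: "\<And>j t. j < k \<Longrightarrow> t \<in> {c - r..c + r} \<Longrightarrow> (diff j has_real_derivative diff (Suc j) t) (at t)"
    and cont: "continuous_on {c - r..c + r} (diff k)"
  shows "\<exists>K\<ge>0. \<forall>y. \<bar>y\<bar> \<le> r \<longrightarrow>
      \<bar>diff 0 (c + y) - (\<Sum>j<k. diff j c / fact j * y ^ j)\<bar> \<le> K * \<bar>y\<bar> ^ k"
proof -
  have "bounded (diff k ` {c - r..c + r})"
    using cont by (intro compact_imp_bounded compact_continuous_image) auto
  then obtain M where M: "\<And>t. t \<in> {c - r..c + r} \<Longrightarrow> \<bar>diff k t\<bar> \<le> M"
    by (force simp: bounded_iff)
  have M0: "0 \<le> M" using M[of c] \<open>0 \<le> r\<close> by force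
  show ?thesis
  proof (intro exI[of _ "M / fact k"] conjI allI impI)
    fix y :: real assume y: "\<bar>y\<bar> \<le> r"
    show "\<bar>diff 0 (c + y) - (\<Sum>j<k. diff j c / fact j * y ^ j)\<bar> \<le> M / fact k * \<bar>y\<bar> ^ k"
    \<comment> \<open>\<open>Taylor\<close> requires a point different from the centre; at
      \<open>y = 0\<close> only the term \<open>j = 0\<close> of the polynomial survives. Otherwise
      the Lagrange remainder is controlled by the bound on \<open>diff k\<close>.\<close>
    proof (cases "y = 0")
      case True
      have "(\<Sum>j<k. diff j c / fact j * 0 ^ j) = diff 0 c"
        using \<open>0 < k\<close> by (subst sum.remove[of _ 0]) auto
      then show ?thesis using True M0 by simp
    next
      case False
      have "\<exists>t. (if c + y < c then c + y < t \<and> t < c else c < t \<and> t < c + y) \<and>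
        diff 0 (c + y) = (\<Sum>j<k. (diff j c / fact j) * (c + y - c)^j) + (diff k t / fact k) * (c + y - c)^k"
        by (rule Taylor[where a="c - r" and b="c + r"]) (use assms y False D in auto)
      then obtain t where t': "if c + y < c then c + y < t \<and> t < c else c < t \<and> t < c + y"
        and t: "diff 0 (c + y) - (\<Sum>j<k. diff j c / fact j * y ^ j) = diff k t / fact k * y ^ k"
        by auto
      have "t \<in> {c - r..c + r}" using t' y by (auto split: if_splits)
      have "\<bar>diff k t\<bar> / fact k * \<bar>y\<bar> ^ k \<le> M / fact k * \<bar>y\<bar> ^ k"
        using M \<open>t \<in> _\<close> by (intro mult_right_mono divide_right_mono) auto
      with t show ?thesis by (simp add: abs_mult power_abs)
    qed
  qed (use M0 in auto)
qed

text \<open>First order is enough here: in the energy this error multiplies the square of the weak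
  derivative, so the product is already cubic.\<close>

lemma powr_near_1:
  "\<exists>K\<ge>0. \<forall>y::real. \<bar>y\<bar> \<le> 1 / 2 \<longrightarrow> \<bar>(1 + y) powr a - 1\<bar> \<le> K * \<bar>y\<bar>"
proof -
  let ?d = "\<lambda>j x::real. if j = (0::nat) then x powr a else a * x powr (a - 1)"
  have "\<exists>K\<ge>0. \<forall>y. \<bar>y\<bar> \<le> 1 / 2 \<longrightarrow>
      \<bar>?d 0 (1 + y) - (\<Sum>j<1. ?d j 1 / fact j * y ^ j)\<bar> \<le> K * \<bar>y\<bar> ^ 1"
    by (rule taylor_remainder_bound[of 1 "1 / 2" 1 ?d])
       (auto intro!: derivative_eq_intros continuous_intros)
  then show ?thesis by simp
qed

text \<open>With \<open>s = n + m\<close>, the second derivative of \<open>V n m\<close> is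
  \<open>x powr (- s)\<close> in all three cases of the definition. Hence the value and slope at 1
  are 0 and the second derivative there is 1, while the third derivative is bounded on
  [1/2, 3/2].\<close>

lemma V_near_1:
  "\<exists>K\<ge>0. \<forall>y::real. \<bar>y\<bar> \<le> 1 / 2 \<longrightarrow> \<bar>V n m (1 + y) - y\<^sup>2 / 2\<bar> \<le> K * \<bar>y\<bar> ^ 3"
proof -
  define s where "s = n + m"
  \<comment> \<open>This is the first derivative of the potential. The logarithmic case
    \<open>s = 2\<close> falls under the generic formula, giving \<open>1 - 1 / x\<close>; only
    \<open>s = 1\<close> needs a logarithm.\<close>
  define V1 where "V1 x = (if s = 1 then ln x else (1 - x powr (1 - s)) / (s - 1))" for x :: real
  define d where "d j = (if j = 0 then V n m else if j = 1 then V1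
    else if j = 2 then (\<lambda>x. x powr (- s)) else (\<lambda>x. - s * x powr (- s - 1)))" for j :: nat
  have pos: "0 < t" if "t \<in> {1 - 1 / 2..1 + 1 / 2}" for t :: real using that by simp
  have D0: "(V n m has_real_derivative V1 t) (at t)" if t: "0 < t" for t
  proof -
    consider "s = 1" | "s = 2" | "s \<noteq> 1" "s \<noteq> 2" by blast
    then show ?thesis
    proof cases
      case 1
      then have "V n m = (\<lambda>x. x * ln x - x + 1)" by (auto simp: V_def s_def fun_eq_iff)
      with 1 t show ?thesis by (auto simp: V1_def intro!: derivative_eq_intros)
    next
      case 2
      then have "V n m = (\<lambda>x. - ln x + x - 1)" by (auto simp: V_def s_def fun_eq_iff)
      with 2 t show ?thesis
        by (auto simp: V1_def powr_minus field_simps intro!: derivative_eq_intros)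
    next
      case 3
      then have "V n m = (\<lambda>x. (x powr (2 - s) - 1 + (s - 2) * (x - 1)) / ((s - 1) * (s - 2)))"
        by (auto simp: V_def s_def fun_eq_iff algebra_simps)
      moreover have "((\<lambda>x. (x powr (2 - s) - 1 + (s - 2) * (x - 1)) / ((s - 1) * (s - 2))) has_real_derivative
          ((2 - s) * t powr (1 - s) + (s - 2)) / ((s - 1) * (s - 2))) (at t)"
        by (intro DERIV_cdivide) (use t in \<open>auto intro!: derivative_eq_intros\<close>)
      moreover have "((2 - s) * t powr (1 - s) + (s - 2)) / ((s - 1) * (s - 2)) = V1 t"
        using 3 by (simp add: V1_def divide_simps) (simp add: algebra_simps)
      ultimately show ?thesis by simp
    qed
  qed
  have D1: "(V1 has_real_derivative t powr (- s)) (at t)" if t: "0 < t" for t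
  proof (cases "s = 1")
    case True
    then have "V1 = ln" by (auto simp: V1_def fun_eq_iff)
    with True t show ?thesis by (auto simp: powr_minus divide_inverse intro!: derivative_eq_intros)
  next
    case False
    then have "V1 = (\<lambda>x. (1 - x powr (1 - s)) / (s - 1))" by (auto simp: V1_def fun_eq_iff)
    moreover have "((\<lambda>x. (1 - x powr (1 - s)) / (s - 1)) has_real_derivative (s - 1) * t powr (- s) / (s - 1)) (at t)"
      by (intro DERIV_cdivide) (use t in \<open>auto intro!: derivative_eq_intros simp: algebra_simps\<close>)
    ultimately show ?thesis using False by simp
  qed
  have D2: "((\<lambda>x. x powr (- s)) has_real_derivative - s * t powr (- s - 1)) (at t)" if "0 < t" for t
    using that by (auto intro!: derivative_eq_intros)
  have "(d j has_real_derivative d (Suc j) t) (at t)" if "j < 3" "t \<in> {1 - 1 / 2..1 + 1 / 2}" for j t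
  proof -
    have "j = 0 \<or> j = 1 \<or> j = 2" using that(1) by linarith
    then show ?thesis using D0[OF pos[OF that(2)]] D1[OF pos[OF that(2)]] D2[OF pos[OF that(2)]]
      by (auto simp: d_def)
  qed
  moreover have "continuous_on {1 - 1 / 2..1 + 1 / 2} (d 3)"
    by (auto simp: d_def intro!: continuous_intros)
  ultimately have K: "\<exists>K\<ge>0. \<forall>y. \<bar>y\<bar> \<le> 1 / 2 \<longrightarrow>
      \<bar>d 0 (1 + y) - (\<Sum>j<3. d j 1 / fact j * y ^ j)\<bar> \<le> K * \<bar>y\<bar> ^ 3"
    by (intro taylor_remainder_bound) auto
  have "V n m 1 = 0" by (simp add: V_def)
  then have "(\<Sum>j<3. d j 1 / fact j * y ^ j) = y\<^sup>2 / 2" for y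
    by (simp add: d_def V1_def eval_nat_numeral)
  moreover have "d 0 = V n m" by (simp add: d_def)
  ultimately show ?thesis using K by (simp only:)
qed

section \<open>The energy near the constant 1\<close>

lemma H1_weak_deriv:
  assumes "p \<in> H1"
  shows "has_weak_derivative p (weak_deriv p)" "integrable lborel (\<lambda>z. (weak_deriv p z)\<^sup>2)"
proof -
  obtain g where g: "has_weak_derivative p g" "integrable lborel (\<lambda>z. (g z)\<^sup>2)"
    using assms by (auto simp: H1_def)
  show *: "has_weak_derivative p (weak_deriv p)"
    unfolding weak_deriv_def using g(1) by (rule someI[of "has_weak_derivative p"])
  have [measurable]: "g \<in> borel_measurable borel" "weak_deriv p \<in> borel_measurable borel"
    using g(1) * by (auto simp: has_weak_derivative_def locally_integrable_def)
  \<comment> \<open>The choice in \<open>weak_deriv\<close> promises only a weak derivative. Square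
    integrability is transferred from the witness \<open>g\<close> by uniqueness.\<close>
  have "AE z in lborel. (weak_deriv p z)\<^sup>2 = (g z)\<^sup>2"
    using has_weak_derivative_unique[OF * g(1)] by eventually_elim simp
  then show "integrable lborel (\<lambda>z. (weak_deriv p z)\<^sup>2)"
    using g(2) by (subst integrable_cong_AE[where g="\<lambda>z. (g z)\<^sup>2"]) auto
qed

lemma H1_norm_squared:
  assumes "p \<in> H1"
  shows "(H1_norm p)\<^sup>2 = (LBINT z. (p z)\<^sup>2) + (LBINT z. (weak_deriv p z)\<^sup>2)"
proof -
  have "(H1_norm p)\<^sup>2 = (LBINT z. (p z)\<^sup>2 + (weak_deriv p z)\<^sup>2)"
    by (simp add: H1_norm_def)
  then show ?thesis using assms H1_weak_deriv(2)[OF assms] by (simp add: H1_def)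
qed

lemma H1_norm_nonneg: "0 \<le> H1_norm p"
  by (simp add: H1_norm_def)

lemma V_measurable [measurable]: "V n m \<in> borel_measurable borel"
  unfolding V_def[abs_def] by (cases "n + m = 1"; cases "n + m = 2") simp_all

text \<open>Integrability of the density is proved together with the estimate, so
  \<open>energy\<close> is a genuine integral here and not the default value 0. Both
  \<open>\<delta>\<close> and \<open>K\<close> are uniform in p.\<close>

lemma energy_expansion:
  obtains \<delta> K where "0 < \<delta>" "\<And>p. p \<in> H1 \<Longrightarrow> H1_norm p \<le> \<delta> \<Longrightarrow>
      integrable lborel (energy_density n m (\<lambda>z. 1 + p z)) \<and>
      \<bar>energy n m (\<lambda>z. 1 + p z) - 1 / 2 * (H1_norm p)\<^sup>2\<bar> \<le> K * H1_norm p ^ 3"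
proof -
  obtain C where C0: "0 \<le> C" and C: "\<forall>p g N. has_weak_derivative p g \<and>
      integrable lborel (\<lambda>x. (p x)\<^sup>2) \<and> integrable lborel (\<lambda>x. (g x)\<^sup>2) \<and> 0 \<le> N \<and>
      (LBINT x. (p x)\<^sup>2) \<le> N\<^sup>2 \<and> (LBINT x. (g x)\<^sup>2) \<le> N\<^sup>2 \<longrightarrow> (AE x in lborel. \<bar>p x\<bar> \<le> C * N)"
    using sobolev_sup_bound by auto
  obtain K1 where K1: "0 \<le> K1" "\<And>y::real. \<bar>y\<bar> \<le> 1 / 2 \<Longrightarrow> \<bar>(1 + y) powr (- 2 * m) - 1\<bar> \<le> K1 * \<bar>y\<bar>"
    using powr_near_1[of "- 2 * m"] by blast
  obtain K2 where K2: "0 \<le> K2" "\<And>y::real. \<bar>y\<bar> \<le> 1 / 2 \<Longrightarrow> \<bar>V n m (1 + y) - y\<^sup>2 / 2\<bar> \<le> K2 * \<bar>y\<bar> ^ 3"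
    using V_near_1[of n m] by blast
  define K where "K = (K1 + K2) * C"
  show ?thesis
  \<comment> \<open>This radius ensures \<open>C * N \<le> 1 / 2\<close>, the range of both Taylor
    estimates; the added 1 keeps the denominator positive when \<open>C = 0\<close>.\<close>
  proof (rule that[of "1 / (2 * (C + 1))" K])
    show "0 < 1 / (2 * (C + 1))" using C0 by simp
    fix p assume p: "p \<in> H1" and small: "H1_norm p \<le> 1 / (2 * (C + 1))"
    define N where "N = H1_norm p"
    define g where "g = weak_deriv p"
    have N0: "0 \<le> N" by (simp add: N_def H1_norm_nonneg)
    have p2: "integrable lborel (\<lambda>z. (p z)\<^sup>2)" and g2: "integrable lborel (\<lambda>z. (g z)\<^sup>2)"
      and wd: "has_weak_derivative p g"
      using p H1_weak_deriv[OF p] by (auto simp: H1_def g_def)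
    have [measurable]: "p \<in> borel_measurable borel" "g \<in> borel_measurable borel"
      using wd by (auto simp: has_weak_derivative_def locally_integrable_def)
    have N2: "N\<^sup>2 = (LBINT z. (p z)\<^sup>2) + (LBINT z. (g z)\<^sup>2)"
      using H1_norm_squared[OF p] by (simp add: N_def g_def)
    have "0 \<le> (LBINT z. (p z)\<^sup>2)" "0 \<le> (LBINT z. (g z)\<^sup>2)" by simp_all
    then have sup: "AE z in lborel. \<bar>p z\<bar> \<le> C * N"
      using C[rule_format, of p g N] wd p2 g2 N0 by (simp add: N2)
    have CN: "C * N \<le> 1 / 2"
    proof -
      have "C * N \<le> (C + 1) * (1 / (2 * (C + 1)))"
        using C0 N0 small by (intro mult_mono) (auto simp: N_def)
      also have "\<dots> = 1 / 2" using C0 by simp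
      finally show ?thesis .
    qed
    define e where "e = energy_density n m (\<lambda>z. 1 + p z)"
    have e_eq: "e z = 1 / 2 * (1 + p z) powr (- 2 * m) * (g z)\<^sup>2 + V n m (1 + p z)" for z
      by (simp add: e_def energy_density_def weak_deriv_const_add g_def)
    have [measurable]: "e \<in> borel_measurable borel" unfolding e_eq[abs_def] by measurable
    \<comment> \<open>The density of the quadratic part. Domination will show \<open>e - q\<close>
      to be integrable, and integrability of \<open>e\<close> then follows from that of
      \<open>q\<close>.\<close>
    define q where "q z = 1 / 2 * ((p z)\<^sup>2 + (g z)\<^sup>2)" for z
    have q: "integrable lborel q" "(LBINT z. q z) = 1 / 2 * N\<^sup>2"
      using p2 g2 unfolding q_def N2 by simp_all
    have bound: "AE z in lborel. \<bar>e z - q z\<bar> \<le> K * N * ((p z)\<^sup>2 + (g z)\<^sup>2)"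
      using sup
    proof eventually_elim
      case (elim z)
      then have h: "\<bar>p z\<bar> \<le> 1 / 2" using CN by linarith
      have "e z - q z = 1 / 2 * ((1 + p z) powr (- 2 * m) - 1) * (g z)\<^sup>2 + (V n m (1 + p z) - (p z)\<^sup>2 / 2)"
        by (simp add: e_eq q_def algebra_simps)
      also have "\<bar>\<dots>\<bar> \<le> 1 / 2 * \<bar>(1 + p z) powr (- 2 * m) - 1\<bar> * (g z)\<^sup>2 + \<bar>V n m (1 + p z) - (p z)\<^sup>2 / 2\<bar>"
        by (rule order_trans[OF abs_triangle_ineq]) (simp add: abs_mult)
      also have "\<dots> \<le> 1 * (K1 * \<bar>p z\<bar>) * (g z)\<^sup>2 + K2 * \<bar>p z\<bar> ^ 3"
        using K1(2)[OF h] K2(2)[OF h] K1(1) by (intro add_mono mult_mono) auto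
      \<comment> \<open>One factor |p| is split off from both errors and replaced by its sup bound
        \<open>C * N\<close>; what remains is quadratic and integrates to a multiple of
        \<open>N^2\<close>, which produces the cubic order.\<close>
      also have "\<dots> = \<bar>p z\<bar> * (K1 * (g z)\<^sup>2 + K2 * (p z)\<^sup>2)"
        by (simp add: algebra_simps power3_eq_cube power2_eq_square)
      also have "\<dots> \<le> (C * N) * ((K1 + K2) * (g z)\<^sup>2 + (K1 + K2) * (p z)\<^sup>2)"
        using elim K1(1) K2(1) C0 N0 by (intro mult_mono add_mono) auto
      also have "\<dots> = K * N * ((p z)\<^sup>2 + (g z)\<^sup>2)" by (simp add: K_def algebra_simps)
      finally show ?case .
    qed
    have r: "integrable lborel (\<lambda>z. K * N * ((p z)\<^sup>2 + (g z)\<^sup>2))" using p2 g2 by simp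
    have eq: "integrable lborel (\<lambda>z. e z - q z)"
    proof (rule Bochner_Integration.integrable_bound[OF r])
      show "AE z in lborel. norm (e z - q z) \<le> norm (K * N * ((p z)\<^sup>2 + (g z)\<^sup>2))"
        using bound by eventually_elim simp
    qed (simp add: q_def)
    have ie: "integrable lborel e" using Bochner_Integration.integrable_add[OF eq q(1)] by simp
    have "energy n m (\<lambda>z. 1 + p z) - 1 / 2 * N\<^sup>2 = (LBINT z. e z - q z)"
      using ie q by (simp add: energy_def e_def)
    also have "\<bar>\<dots>\<bar> \<le> (LBINT z. K * N * ((p z)\<^sup>2 + (g z)\<^sup>2))"
      using integral_abs_bound[of lborel "\<lambda>z. e z - q z"]
        integral_mono_AE[OF integrable_abs[OF eq] r bound] by linarith
    also have "\<dots> = K * N * N\<^sup>2" using p2 g2 by (simp add: N2)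
    also have "\<dots> = K * N ^ 3" by (simp add: power3_eq_cube power2_eq_square)
    finally show "integrable lborel (energy_density n m (\<lambda>z. 1 + p z)) \<and>
      \<bar>energy n m (\<lambda>z. 1 + p z) - 1 / 2 * (H1_norm p)\<^sup>2\<bar> \<le> K * H1_norm p ^ 3"
      using ie unfolding e_def N_def by blast
  qed
qed

text \<open>The neighbourhood of 0 is taken as all norms below \<open>\<delta>\<close>, so a
  statement for every p in \<open>H1\<close> of norm at most \<open>\<delta>\<close> suffices;
  intersecting with the principal filter restricts to \<open>H1\<close>.\<close>

lemma eventually_H1_to_zero:
  assumes "0 < \<delta>" "\<And>p. p \<in> H1 \<Longrightarrow> H1_norm p \<le> \<delta> \<Longrightarrow> P p"
  shows "\<forall>\<^sub>F p in H1_to_zero. P p"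
proof -
  have "\<forall>\<^sub>F x in nhds 0. x < \<delta>"
    using eventually_nhds_in_open[of "{..<\<delta>}" 0] assms(1) by simp
  then have "\<forall>\<^sub>F p in filtercomap H1_norm (nhds 0). H1_norm p < \<delta>"
    by (rule eventually_filtercomapI)
  then show ?thesis unfolding H1_to_zero_def eventually_inf_principal
    by eventually_elim (use assms(2) in auto)
qed

theorem theorem3p2:
  fixes n m :: real
  shows "(\<forall>\<^sub>F p in H1_to_zero. integrable lborel (energy_density n m (\<lambda>z. 1 + p z))) \<and>
         (\<lambda>p. energy n m (\<lambda>z. 1 + p z) - 1 / 2 * (H1_norm p)\<^sup>2)
           \<in> O[H1_to_zero](\<lambda>p. H1_norm p ^ 3)"
proof -
  obtain \<delta> K where *: "0 < \<delta>" "\<And>p. p \<in> H1 \<Longrightarrow> H1_norm p \<le> \<delta> \<Longrightarrow>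
      integrable lborel (energy_density n m (\<lambda>z. 1 + p z)) \<and>
      \<bar>energy n m (\<lambda>z. 1 + p z) - 1 / 2 * (H1_norm p)\<^sup>2\<bar> \<le> K * H1_norm p ^ 3"
    using energy_expansion by blast
  show ?thesis
  proof
    show "\<forall>\<^sub>F p in H1_to_zero. integrable lborel (energy_density n m (\<lambda>z. 1 + p z))"
      by (rule eventually_H1_to_zero[OF *(1)]) (use *(2) in blast)
    show "(\<lambda>p. energy n m (\<lambda>z. 1 + p z) - 1 / 2 * (H1_norm p)\<^sup>2)
           \<in> O[H1_to_zero](\<lambda>p. H1_norm p ^ 3)"
      by (rule bigoI[of _ K], rule eventually_H1_to_zero[OF *(1)])
         (use *(2) H1_norm_nonneg in \<open>auto simp: abs_of_nonneg\<close>)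
  qed
qed

end
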